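(* Let $\rho$ be a density matrix on a $d$-dimensional Hilbert space with orthonormal basis $|0\rangle,\dots,|d-1\rangle$, let $V_{12},V_{23},\dots$ be arbitrary $d\times d$ unitary matrices, and let $\rho_1,\rho_2,\dots$ be the diagonal density matrices obtained after successive non-selective measurements with the projectors $|f\rangle\langle f|$, with unitary evolution $V_{s,s+1}$ between the $s$-th and $(s+1)$-th measurement, as defined in the context. Let $\mathcal{B}(\rho_s)$ be the convex polytope of diagonal density matrices associated with $\rho_s$ (defined in the context; it depends only on $\rho_s$). Then for every $s\ge 1$: (1) $\mathcal{B}(\rho_s)$ contains all future density matrices $\rho_t$ with $t>s$; (2) the minimum entropy of all density matrices in $\mathcal{B}(\rho_s)$ is $E(\rho_s)$; (3) $\Delta_0\subseteq\mathcal{B}(\rho_{s+1})\subseteq\mathcal{B}(\rho_s)\subseteq\Delta_{d-1}$, and the minimum entropy of the density matrices in $\mathcal{B}(\rho_s)$ is non-decreasing in $s$.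
   Context: The von Neumann entropy of a density matrix $\sigma$ is $E(\sigma)=-\mathrm{Tr}(\sigma\log\sigma)$. Let $\mathfrak{P}_f=|f\rangle\langle f|$ for $f=0,\dots,d-1$. The process is $$\rho_1=\sum_f\mathfrak{P}_f\rho\,\mathfrak{P}_f,\qquad \widetilde\rho_{s+1}=V_{s,s+1}^\dagger\rho_sV_{s,s+1},\qquad \rho_{s+1}=\sum_f\mathfrak{P}_f\widetilde\rho_{s+1}\mathfrak{P}_f\quad(s\ge1).$$ Each $\rho_s$ is diagonal in the basis $|f\rangle$: $\rho_s=\mathrm{diag}(x^{(s)}_0,\dots,x^{(s)}_{d-1})$, where $(x^{(s)}_0,\dots,x^{(s)}_{d-1})$ is a probability vector. For a diagonal density matrix $\sigma=\mathrm{diag}(x_0,\dots,x_{d-1})$, the polytope $\mathcal{B}(\sigma)$ is the set of all diagonal density matrices whose diagonal is a convex combination of permutations of $(x_0,\dots,x_{d-1})$: $$\mathcal{B}(\sigma)=\Big\{\sum_\pi\lambda(\pi)\,\mathrm{diag}(x_{\pi^{-1}(0)},\dots,x_{\pi^{-1}(d-1)}) : \lambda(\pi)\ge0,\ \sum_\pi\lambda(\pi)=1\Big\},$$ $\pi$ running over all permutations of $\{0,\dots,d-1\}$. Here $\Delta_{d-1}$ denotes the set of all diagonal $d\times d$ density matrices, and $\Delta_0=\{\tfrac1d\mathbf{1}\}$. *)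

theory Defs
  imports "HOL-Analysis.Analysis"
begin

text \<open>
  The Hilbert space of dimension \<open>d\<close> is \<open>complex ^ 'n\<close> with \<open>d = CARD('n)\<close>; operators are given by
  their matrices in the orthonormal basis \<open>axis f 1\<close>, where \<open>f\<close> ranges over \<open>'n\<close>.
\<close>

definition adj :: "complex^'n^'n \<Rightarrow> complex^'n^'n" where
  "adj A = (\<chi> i j. cnj (A $ j $ i))"

definition unitary_mat :: "complex^'n^'n \<Rightarrow> bool" where
  "unitary_mat U \<longleftrightarrow> adj U ** U = mat 1 \<and> U ** adj U = mat 1"

definition diag_mat :: "complex^'n \<Rightarrow> complex^'n^'n" where
  "diag_mat x = (\<chi> i j. if i = j then x $ i else 0)"

definition is_diag :: "complex^'n^'n \<Rightarrow> bool" where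
  "is_diag A \<longleftrightarrow> (\<forall>i j. i \<noteq> j \<longrightarrow> A $ i $ j = 0)"

definition psd :: "complex^'n^'n \<Rightarrow> bool" where
  "psd A \<longleftrightarrow> adj A = A \<and> (\<forall>v. 0 \<le> Re (\<Sum>i\<in>UNIV. cnj (v $ i) * (A *v v) $ i))"

definition density_matrix :: "complex^'n^'n \<Rightarrow> bool" where
  "density_matrix \<sigma> \<longleftrightarrow> psd \<sigma> \<and> trace \<sigma> = 1"

text \<open>
  Functional calculus for Hermitian matrices. The result does not depend on the chosen
  diagonalisation, see \<open>spectral_rep_unique\<close> below.
\<close>

definition spectral_rep :: "complex^'n^'n \<Rightarrow> complex^'n^'n \<Rightarrow> real^'n \<Rightarrow> bool" where
  "spectral_rep A U l \<longleftrightarrow>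
     unitary_mat U \<and> A = U ** diag_mat (\<chi> i. of_real (l $ i)) ** adj U"

definition mat_fun :: "(real \<Rightarrow> real) \<Rightarrow> complex^'n^'n \<Rightarrow> complex^'n^'n" where
  "mat_fun f A = (THE B. \<exists>U l. spectral_rep A U l \<and>
     B = U ** diag_mat (\<chi> i. of_real (f (l $ i))) ** adj U)"

text \<open>
  The logarithm is natural. Since \<open>ln 0 = 0\<close>, zero eigenvalues of \<open>\<sigma>\<close> contribute \<open>0\<close> to
  \<open>Tr (\<sigma> log \<sigma>)\<close>, which is the usual convention \<open>0 log 0 = 0\<close>. The trace is real, so that
  \<open>Re\<close> only changes the type.
\<close>

definition entropy :: "complex^'n^'n \<Rightarrow> real" where
  "entropy \<sigma> = - Re (trace (\<sigma> ** mat_fun ln \<sigma>))"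

definition ket_bra :: "complex^'n \<Rightarrow> complex^'n \<Rightarrow> complex^'n^'n" where
  "ket_bra u v = (\<chi> i j. u $ i * cnj (v $ j))"

definition proj :: "'n \<Rightarrow> complex^'n^'n" where
  "proj f = ket_bra (axis f 1) (axis f 1)"

definition measurement :: "complex^'n^'n \<Rightarrow> complex^'n^'n" where
  "measurement \<sigma> = (\<Sum>f\<in>UNIV. proj f ** \<sigma> ** proj f)"

text \<open>
  \<open>V s\<close> is the unitary evolution between the measurements \<open>s\<close> and \<open>s + 1\<close>. For \<open>s \<ge> 1\<close>,
  \<open>state \<rho> V s\<close> is the density matrix after measurement \<open>s\<close>; index \<open>0\<close> is the initial state.
\<close>

fun state :: "complex^'n^'n \<Rightarrow> (nat \<Rightarrow> complex^'n^'n) \<Rightarrow> nat \<Rightarrow> complex^'n^'n" where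
  "state \<rho> V 0 = \<rho>"
| "state \<rho> V (Suc 0) = measurement \<rho>"
| "state \<rho> V (Suc (Suc s)) =
     measurement (adj (V (Suc s)) ** state \<rho> V (Suc s) ** V (Suc s))"

definition polytope_of :: "complex^'n^'n \<Rightarrow> (complex^'n^'n) set" where
  "polytope_of \<sigma> =
     {\<Sum>p | p permutes UNIV. c p *\<^sub>R diag_mat (\<chi> i. \<sigma> $ (inv p i) $ (inv p i)) | c :: ('n \<Rightarrow> 'n) \<Rightarrow> real.
        (\<forall>p. p permutes UNIV \<longrightarrow> 0 \<le> c p) \<and> (\<Sum>p | p permutes UNIV. c p) = 1}"

definition diag_density :: "(complex^'n^'n) set" where
  "diag_density = {\<sigma>. density_matrix \<sigma> \<and> is_diag \<sigma>}"

definition max_mixed :: "(complex^'n^'n) set" where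
  "max_mixed = {(1 / real CARD('n)) *\<^sub>R mat 1}"

text \<open>Meaningful only if the entropy attains its minimum on \<open>K\<close>.\<close>

definition min_entropy :: "(complex^'n^'n) set \<Rightarrow> real" where
  "min_entropy K = (LEAST e. e \<in> entropy ` K)"

lemma diag_mat_mult:
  "(A ** diag_mat x) $ i $ j = A $ i $ j * x $ j" "(diag_mat x ** A) $ i $ j = x $ i * A $ i $ j"
  by (simp_all add: matrix_matrix_mult_def diag_mat_def if_distrib if_distribR cong: if_cong)

lemma spectral_rep_unique:
  fixes A U W :: "complex^'n^'n"
  assumes "spectral_rep A U l" and "spectral_rep A W m"
  shows "U ** diag_mat (\<chi> i. of_real (f (l $ i))) ** adj U =
         W ** diag_mat (\<chi> i. of_real (f (m $ i))) ** adj W"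
proof -
  define D where "D = (\<lambda>x :: real^'n. diag_mat (\<chi> i. complex_of_real (x $ i)))"
  define F where "F = (\<lambda>x :: real^'n. diag_mat (\<chi> i. complex_of_real (f (x $ i))))"
  define Q where "Q = adj W ** U"
  have U: "adj U ** U = mat 1" "U ** adj U = mat 1" and W: "adj W ** W = mat 1" "W ** adj W = mat 1"
    using assms by (auto simp: spectral_rep_def unitary_mat_def)
  have eq: "U ** D l ** adj U = W ** D m ** adj W"
    using assms by (auto simp: spectral_rep_def D_def)
  have "adj W ** (U ** D l ** adj U) ** U = adj W ** (W ** D m ** adj W) ** U"
    by (simp add: eq)
  hence "Q ** D l ** (adj U ** U) = (adj W ** W) ** D m ** Q"
    by (simp add: Q_def matrix_mul_assoc)
  hence *: "Q ** D l = D m ** Q"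
    by (simp add: U W)
  have "Q $ i $ j * of_real (l $ j) = of_real (m $ i) * Q $ i $ j" for i j
    using arg_cong[OF *, of "\<lambda>M. M $ i $ j"] by (simp add: D_def diag_mat_mult)
  hence "Q $ i $ j = 0 \<or> l $ j = m $ i" for i j
    by (metis mult.commute mult_cancel_left of_real_eq_iff)
  hence "Q $ i $ j * of_real (f (l $ j)) = of_real (f (m $ i)) * Q $ i $ j" for i j
    by (metis mult.commute mult_zero_left)
  hence "Q ** F l = F m ** Q"
    by (simp add: vec_eq_iff F_def diag_mat_mult)
  hence "W ** (Q ** F l) ** adj U = W ** (F m ** Q) ** adj U"
    by simp
  hence "(W ** adj W) ** U ** F l ** adj U = W ** F m ** adj W ** (U ** adj U)"
    by (simp add: Q_def matrix_mul_assoc)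
  thus ?thesis
    by (simp add: U W F_def)
qed

lemma mat_fun_eq:
  assumes "spectral_rep A U l"
  shows "mat_fun f A = U ** diag_mat (\<chi> i. of_real (f (l $ i))) ** adj U"
  unfolding mat_fun_def
  by (rule the_equality) (use assms in \<open>blast intro: spectral_rep_unique\<close>)+

end

theory Submission
  imports Defs
begin

text \<open>
  A measurement that follows a unitary evolution \<open>V\<close> acts on the vector of probabilities as the
  doubly stochastic matrix with entries \<open>\<bar>V\<^sub>j\<^sub>i\<bar>\<^sup>2\<close>. A doubly stochastic matrix \<open>T\<close> sends \<open>x\<close> into the
  convex hull of the permutations of \<open>x\<close> (Rado). To see this without Birkhoff's theorem, separate
  \<open>T x\<close> from the hull by a linear functional \<open>a\<close>. A permutation of \<open>x\<close> that is extremal for \<open>a\<close> is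
  ordered oppositely to \<open>a\<close>, that is, like \<open>-a\<close>, so its pairs of entries with \<open>-a\<close> lie on the graph of the subgradient of a convex
  function, and averaging the subgradient inequalities with the weights \<open>T\<^sub>i\<^sub>j\<close> gives a contradiction.
  The bound on the entropy is the convexity of \<open>t ln t\<close>.
\<close>

section \<open>Convex hulls of permutations of a vector\<close>

text \<open>The coefficients are indexed by \<open>I\<close> rather than by points, so
  \<open>f\<close> need not be injective. \<open>polytope_of\<close> needs this form, because
  distinct permutations give the same matrix when entries repeat.\<close>

lemma convex_hull_finite_family:
  fixes f :: "'i \<Rightarrow> 'a::real_vector"
  assumes "finite I"
  shows "convex hull (f ` I) =
    {\<Sum>p\<in>I. c p *\<^sub>R f p | c. (\<forall>p\<in>I. 0 \<le> c p) \<and> (\<Sum>p\<in>I. c p) = (1::real)}" (is "_ = ?R")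
proof
  show "convex hull (f ` I) \<subseteq> ?R"
  proof (rule hull_minimal)
    show "f ` I \<subseteq> ?R"
    proof
      fix z assume "z \<in> f ` I"
      then obtain q where q: "q \<in> I" "z = f q" by blast
      define c :: "'i \<Rightarrow> real" where "c = (\<lambda>p. if p = q then 1 else 0)"
      have "(\<Sum>p\<in>I. c p *\<^sub>R f p) = (\<Sum>p\<in>I. if p = q then f p else 0)"
        by (intro sum.cong) (auto simp: c_def)
      hence "z = (\<Sum>p\<in>I. c p *\<^sub>R f p)"
        using q assms by (simp add: sum.delta)
      moreover have "(\<forall>p\<in>I. 0 \<le> c p) \<and> (\<Sum>p\<in>I. c p) = 1"
        using q assms by (simp add: c_def sum.delta)
      ultimately show "z \<in> ?R" by blast
    qed
    show "convex ?R"
    proof (rule convexI)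
      fix x y and u v :: real
      assume "x \<in> ?R" "y \<in> ?R" and uv: "0 \<le> u" "0 \<le> v" "u + v = 1"
      then obtain c e where
        c: "x = (\<Sum>p\<in>I. c p *\<^sub>R f p)" "\<forall>p\<in>I. 0 \<le> c p" "(\<Sum>p\<in>I. c p) = 1" and
        e: "y = (\<Sum>p\<in>I. e p *\<^sub>R f p)" "\<forall>p\<in>I. 0 \<le> e p" "(\<Sum>p\<in>I. e p) = 1"
        by blast
      have "u *\<^sub>R x + v *\<^sub>R y = (\<Sum>p\<in>I. (u * c p + v * e p) *\<^sub>R f p)"
        by (simp add: c(1) e(1) scaleR_sum_right sum.distrib scaleR_add_left)
      moreover have "(\<Sum>p\<in>I. u * c p + v * e p) = 1"
        using c(3) e(3) uv(3) by (simp add: sum.distrib flip: sum_distrib_left)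
      moreover have "\<forall>p\<in>I. 0 \<le> u * c p + v * e p"
        using c(2) e(2) uv by simp
      ultimately show "u *\<^sub>R x + v *\<^sub>R y \<in> ?R"
        by (intro CollectI exI[of _ "\<lambda>p. u * c p + v * e p"]) simp
    qed
  qed
  show "?R \<subseteq> convex hull (f ` I)"
    using convex_sum[OF assms convex_convex_hull, of _ f "f ` I"] by (auto simp: hull_inc)
qed

section \<open>Permutations of a vector and doubly stochastic matrices\<close>

definition permutations_of_vec :: "real^'n \<Rightarrow> (real^'n) set" where
  "permutations_of_vec x = (\<lambda>q. \<chi> i. x $ q i) ` {q. q permutes UNIV}"

definition doubly_stochastic :: "real^'n^'n \<Rightarrow> bool" where
  "doubly_stochastic T \<longleftrightarrow> (\<forall>i j. 0 \<le> T $ i $ j) \<and>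
     (\<forall>i. (\<Sum>j\<in>UNIV. T $ i $ j) = 1) \<and> (\<forall>j. (\<Sum>i\<in>UNIV. T $ i $ j) = 1)"

lemma finite_permutations_of_vec: "finite (permutations_of_vec x)"
  by (simp add: permutations_of_vec_def finite_permutations)

lemma self_in_permutations_of_vec: "x \<in> permutations_of_vec x"
  unfolding permutations_of_vec_def
  by (rule image_eqI[of _ _ id]) (auto simp: permutes_id)

text \<open>\<open>\<phi> i\<close> plays the role of the value at \<open>y i\<close> of a convex
  function with subgradient \<open>a i\<close> there. Points are added in increasing order of
  \<open>a i + y i\<close>, each new value being the least one that respects all earlier
  tangents.\<close>

lemma comonotone_potential:
  fixes a y :: "'i \<Rightarrow> real"
  assumes "finite I" and como: "\<And>i k. 0 \<le> (a i - a k) * (y i - y k)"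
  shows "\<exists>\<phi>. \<forall>i\<in>I. \<forall>j\<in>I. \<phi> i + a i * (y j - y i) \<le> (\<phi> j :: real)"
  using assms(1)
proof (induction rule: finite_ranking_induct[where f = "\<lambda>i. a i + y i"])
  case empty
  show ?case by simp
next
  case (insert m S)
  then obtain \<phi> where \<phi>: "\<And>i j. i \<in> S \<Longrightarrow> j \<in> S \<Longrightarrow> \<phi> i + a i * (y j - y i) \<le> \<phi> j"
    by blast
  \<comment> \<open>If one coordinate of \<open>i\<close> exceeded that of \<open>m\<close>,
    comonotonicity would keep the other from being smaller, so the sum at \<open>m\<close> would not
    be maximal.\<close>
  have le: "y i \<le> y m \<and> a i \<le> a m" if "i \<in> S" for i
    using insert(2)[OF that] como[of i m] by (smt (verit) mult_pos_neg mult_neg_pos mult_pos_pos zero_le_mult_iff)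
  show ?case
  \<comment> \<open>The induction rule allows \<open>m \<in> S\<close>, and the maximum below needs
    \<open>S\<close> nonempty.\<close>
  proof (cases "m \<in> S \<or> S = {}")
    case True
    then show ?thesis using \<phi> by (auto simp: insert_absorb)
  next
    case False
    define M where "M = Max ((\<lambda>i. \<phi> i + a i * (y m - y i)) ` S)"
    have upper: "\<phi> i + a i * (y m - y i) \<le> M" if "i \<in> S" for i
      unfolding M_def using that insert(1) by (intro Max_ge) auto
    have "M \<in> (\<lambda>i. \<phi> i + a i * (y m - y i)) ` S"
      unfolding M_def using False insert(1) by (intro Max_in) auto
    then obtain k where k: "k \<in> S" "M = \<phi> k + a k * (y m - y k)" by blast
    have lower: "M + a m * (y i - y m) \<le> \<phi> i" if "i \<in> S" for i
    proof -
      \<comment> \<open>The tangent at \<open>k\<close> passes through height \<open>M\<close> at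
        \<open>y m\<close>. To the left of \<open>y m\<close> the tangent with the steeper slope
        \<open>a m\<close> through that point lies below it, and the tangent at \<open>k\<close>
        lies below \<open>\<phi> i\<close>.\<close>
      have "0 \<le> (a m - a k) * (y m - y i)"
        using le[OF k(1)] le[OF that] by simp
      thus ?thesis using \<phi>[OF k(1) that] k(2) by (simp add: algebra_simps)
    qed
    show ?thesis
      by (rule exI[of _ "\<phi>(m := M)"]) (use upper lower \<phi> False in auto)
  qed
qed

text \<open>Average the subgradient inequalities over all pairs with weights
  \<open>T $ i $ j\<close>. Row sums and column sums both being 1, the potential cancels.\<close>

lemma doubly_stochastic_rearrangement:
  fixes a y :: "real^'n"
  assumes T: "doubly_stochastic T" and como: "\<And>i k. 0 \<le> (a $ i - a $ k) * (y $ i - y $ k)"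
  shows "a \<bullet> (T *v y) \<le> a \<bullet> y"
proof -
  obtain \<phi> where \<phi>: "\<And>i j. \<phi> i + a $ i * (y $ j - y $ i) \<le> (\<phi> j :: real)"
    using comonotone_potential[of UNIV "\<lambda>i. a $ i" "\<lambda>i. y $ i"] como by auto
  have row: "(\<Sum>j\<in>UNIV. T $ i $ j) = 1" and col: "(\<Sum>i\<in>UNIV. T $ i $ j) = 1" for i j
    using T by (auto simp: doubly_stochastic_def)
  \<comment> \<open>The row sum, equal to 1, is inserted so that the differences
    \<open>y $ j - y $ i\<close> appear under the double sum.\<close>
  have "a \<bullet> (T *v y) - a \<bullet> y = (\<Sum>i\<in>UNIV. a $ i * (\<Sum>j\<in>UNIV. T $ i $ j * y $ j)
      - a $ i * y $ i * (\<Sum>j\<in>UNIV. T $ i $ j))"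
    by (simp add: inner_vec_def matrix_vector_mult_def row sum_subtractf)
  also have "\<dots> = (\<Sum>i\<in>UNIV. \<Sum>j\<in>UNIV. T $ i $ j * (a $ i * (y $ j - y $ i)))"
    by (simp add: sum_distrib_left sum_subtractf algebra_simps)
  also have "\<dots> \<le> (\<Sum>i\<in>UNIV. \<Sum>j\<in>UNIV. T $ i $ j * (\<phi> j - \<phi> i))"
    using T \<phi> by (intro sum_mono mult_left_mono) (auto simp: doubly_stochastic_def algebra_simps)
  also have "\<dots> = (\<Sum>i\<in>UNIV. \<Sum>j\<in>UNIV. T $ i $ j * \<phi> j) - (\<Sum>i\<in>UNIV. (\<Sum>j\<in>UNIV. T $ i $ j) * \<phi> i)"
    by (simp add: sum_distrib_right sum_subtractf right_diff_distrib)
  also have "(\<Sum>i\<in>UNIV. \<Sum>j\<in>UNIV. T $ i $ j * \<phi> j) = (\<Sum>j\<in>UNIV. (\<Sum>i\<in>UNIV. T $ i $ j) * \<phi> j)"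
    by (subst sum.swap) (simp add: sum_distrib_right)
  finally show ?thesis by (simp add: row col)
qed

text \<open>This turns minimality under swaps of two entries into a sign condition on their
  order.\<close>

lemma inner_transpose_entries:
  fixes a y :: "real^'n"
  shows "a \<bullet> (\<chi> l. y $ Transposition.transpose i k l) = a \<bullet> y + (a $ i - a $ k) * (y $ k - y $ i)"
proof (cases "i = k")
  case False
  have "a \<bullet> (\<chi> l. y $ Transposition.transpose i k l) - a \<bullet> y = (\<Sum>l\<in>UNIV. a $ l * (y $ Transposition.transpose i k l - y $ l))"
    by (simp add: inner_vec_def sum_subtractf algebra_simps)
  also have "\<dots> = (\<Sum>l\<in>{i, k}. a $ l * (y $ Transposition.transpose i k l - y $ l))"
    by (rule sum.mono_neutral_right) (auto simp: Transposition.transpose_def)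
  finally show ?thesis using False by (simp add: algebra_simps)
qed simp

theorem doubly_stochastic_in_hull:
  fixes x :: "real^'n"
  assumes T: "doubly_stochastic T"
  shows "T *v x \<in> convex hull permutations_of_vec x"
proof (rule ccontr)
  assume "T *v x \<notin> convex hull permutations_of_vec x"
  moreover have "closed (convex hull permutations_of_vec x)"
    by (intro compact_imp_closed finite_imp_compact_convex_hull finite_permutations_of_vec)
  ultimately obtain a b where ab: "a \<bullet> (T *v x) < b"
    "\<And>z. z \<in> convex hull permutations_of_vec x \<Longrightarrow> b < a \<bullet> z"
    using separating_hyperplane_closed_point[OF convex_convex_hull] by blast
  obtain y where y: "y \<in> permutations_of_vec x"
    and min: "\<And>z. z \<in> permutations_of_vec x \<Longrightarrow> a \<bullet> y \<le> a \<bullet> z"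
    using ex_is_arg_min_if_finite[OF finite_permutations_of_vec, of x "\<lambda>z. a \<bullet> z"]
      self_in_permutations_of_vec[of x] by (force simp: is_arg_min_linorder)
  obtain q where q: "q permutes UNIV" and yq: "y = (\<chi> i. x $ q i)"
    using y by (auto simp: permutations_of_vec_def)
  \<comment> \<open>A swap of two entries of \<open>y\<close> yields another permutation of
    \<open>x\<close>, so it cannot lower the inner product with \<open>a\<close>.\<close>
  have "0 \<le> ((- a) $ i - (- a) $ k) * (y $ i - y $ k)" for i k
  proof -
    have "(\<chi> l. y $ Transposition.transpose i k l) \<in> permutations_of_vec x"
      unfolding permutations_of_vec_def
      by (rule image_eqI[of _ _ "q \<circ> Transposition.transpose i k"])
        (auto simp: yq intro: permutes_compose permutes_swap_id q)
    from min[OF this] show ?thesis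
      by (simp add: inner_transpose_entries algebra_simps)
  qed
  \<comment> \<open>Permuting the columns of \<open>T\<close> by \<open>q\<close> compensates for
    replacing \<open>x\<close> by \<open>y\<close>.\<close>
  moreover define S where "S = (\<chi> i j. T $ i $ q j)"
  moreover have "doubly_stochastic S"
    using T sum.permute[OF q, of "\<lambda>j. T $ i $ j" for i]
    by (auto simp: S_def doubly_stochastic_def o_def)
  ultimately have "(- a) \<bullet> (S *v y) \<le> (- a) \<bullet> y"
    by (intro doubly_stochastic_rearrangement)
  moreover have "S *v y = T *v x"
    using sum.permute[OF q, of "\<lambda>j. T $ i $ j * x $ j" for i]
    by (simp add: S_def yq matrix_vector_mult_def vec_eq_iff o_def)
  \<comment> \<open>The chain is
    \<open>a \<bullet> y \<le> a \<bullet> (T *v x) < b < a \<bullet> y\<close>.\<close>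
  ultimately show False
    using ab(1) ab(2)[OF hull_inc[OF y]] by simp
qed

text \<open>Permuting the entries of \<open>T *v x\<close> amounts to permuting the rows of
  \<open>T\<close>, which keeps it doubly stochastic. This is the source of the nesting of the
  polytopes.\<close>

lemma hull_permutations_doubly_stochastic:
  fixes x :: "real^'n"
  assumes T: "doubly_stochastic T"
  shows "convex hull permutations_of_vec (T *v x) \<subseteq> convex hull permutations_of_vec x"
proof (rule hull_minimal)
  show "permutations_of_vec (T *v x) \<subseteq> convex hull permutations_of_vec x"
  proof
    fix z assume "z \<in> permutations_of_vec (T *v x)"
    then obtain q where q: "q permutes UNIV" and z: "z = (\<chi> i. (T *v x) $ q i)"
      by (auto simp: permutations_of_vec_def)
    have "doubly_stochastic (\<chi> i. T $ q i)"
      using T sum.permute[OF q, of "\<lambda>i. T $ i $ j" for j]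
      by (auto simp: doubly_stochastic_def o_def)
    moreover have "z = (\<chi> i. T $ q i) *v x"
      by (simp add: z matrix_vector_mult_def vec_eq_iff)
    ultimately show "z \<in> convex hull permutations_of_vec x"
      using doubly_stochastic_in_hull by blast
  qed
qed simp

section \<open>Probability vectors and convexity of t ln t\<close>

definition prob_vec :: "real^'n \<Rightarrow> bool" where
  "prob_vec x \<longleftrightarrow> (\<forall>i. 0 \<le> x $ i) \<and> (\<Sum>i\<in>UNIV. x $ i) = 1"

lemma prob_vec_doubly_stochastic:
  assumes T: "doubly_stochastic T" and x: "prob_vec x"
  shows "prob_vec (T *v x)"
proof -
  have "(\<Sum>i\<in>UNIV. \<Sum>j\<in>UNIV. T $ i $ j * x $ j) = (\<Sum>j\<in>UNIV. (\<Sum>i\<in>UNIV. T $ i $ j) * x $ j)"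
    by (subst sum.swap) (simp add: sum_distrib_right)
  thus ?thesis
    using T x by (auto simp: prob_vec_def doubly_stochastic_def matrix_vector_mult_def intro!: sum_nonneg)
qed

lemma hull_permutations_prob_vec:
  assumes "prob_vec x" "y \<in> convex hull permutations_of_vec x"
  shows "prob_vec y"
proof -
  have "convex {y :: real^'n. prob_vec y}"
    by (rule convexI) (auto simp: prob_vec_def sum.distrib simp flip: sum_distrib_left)
  moreover have "permutations_of_vec x \<subseteq> {y. prob_vec y}"
    using assms(1) sum.permute[of _ UNIV "\<lambda>i. x $ i"]
    by (auto simp: permutations_of_vec_def prob_vec_def o_def)
  ultimately show ?thesis
    using hull_minimal[of "permutations_of_vec x" "{y. prob_vec y}" convex] assms(2) by auto
qed

lemma convex_on_mult_ln: "convex_on {0..} (\<lambda>t::real. t * ln t)"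
proof (rule convex_onI)
  fix t x y :: real
  assume t: "0 < t" "t < 1" and xy: "x \<in> {0..}" "y \<in> {0..}"
  define z where "z = (1 - t) * x + t * y"
  show "((1 - t) *\<^sub>R x + t *\<^sub>R y) * ln ((1 - t) *\<^sub>R x + t *\<^sub>R y) \<le> (1 - t) * (x * ln x) + t * (y * ln y)"
  proof (cases "z = 0")
    case True
    hence "x = 0" "y = 0"
      using t xy by (auto simp: z_def add_nonneg_eq_0_iff)
    thus ?thesis by simp
  next
    case False
    hence z: "0 < z" using t xy by (simp add: z_def order_less_le)
    \<comment> \<open>The left side is the tangent at \<open>z\<close>, of slope
      \<open>ln z + 1\<close>; the bound is \<open>ln u \<le> u - 1\<close> at
      \<open>u = z / w\<close>. Averaged over \<open>x\<close> and \<open>y\<close>, its linear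
      terms cancel.\<close>
    have tangent: "w * ln z + w - z \<le> w * ln w" if "0 \<le> w" for w
    proof (cases "w = 0")
      case False
      hence w: "0 < w" using that by simp
      have "w * ln (z / w) \<le> w * (z / w - 1)"
        using w z by (intro mult_left_mono ln_le_minus_one) auto
      moreover have "w * ln (z / w) = w * ln z - w * ln w"
        using w z by (simp add: ln_div right_diff_distrib)
      moreover have "w * (z / w - 1) = z - w"
        using w by (simp add: right_diff_distrib)
      ultimately show ?thesis by linarith
    qed (use z in simp)
    have "(1 - t) * (x * ln z + x - z) + t * (y * ln z + y - z) \<le> (1 - t) * (x * ln x) + t * (y * ln y)"
      using t xy by (intro add_mono mult_left_mono tangent) auto
    moreover have "(1 - t) * (x * ln z + x - z) + t * (y * ln z + y - z) = z * ln z"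
      unfolding z_def by (simp add: algebra_simps)
    ultimately show ?thesis by (simp add: z_def)
  qed
qed simp

text \<open>The sum is convex on the hull and takes the same value at all permutations of
  \<open>x\<close>, so that value bounds it. Entries in the hull are nonnegative, where t ln t is
  convex.\<close>

lemma neg_entropy_hull_permutations_le:
  fixes x :: "real^'n"
  assumes x: "prob_vec x" and y: "y \<in> convex hull permutations_of_vec x"
  shows "(\<Sum>i\<in>UNIV. y $ i * ln (y $ i)) \<le> (\<Sum>i\<in>UNIV. x $ i * ln (x $ i))"
proof -
  let ?H = "convex hull permutations_of_vec x"
  have "convex_on ?H (\<lambda>y. \<Sum>i\<in>UNIV. y $ i * ln (y $ i))"
  proof (rule convex_onI)
    fix t :: real and u v :: "real^'n"
    assume t: "0 < t" "t < 1" and uv: "u \<in> ?H" "v \<in> ?H"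
    have "0 \<le> u $ i" "0 \<le> v $ i" for i
      using hull_permutations_prob_vec[OF x] uv by (auto simp: prob_vec_def)
    hence "(\<Sum>i\<in>UNIV. ((1 - t) *\<^sub>R u + t *\<^sub>R v) $ i * ln (((1 - t) *\<^sub>R u + t *\<^sub>R v) $ i))
        \<le> (\<Sum>i\<in>UNIV. (1 - t) * (u $ i * ln (u $ i)) + t * (v $ i * ln (v $ i)))"
      using t convex_onD[OF convex_on_mult_ln, of t] by (intro sum_mono) auto
    thus "(\<Sum>i\<in>UNIV. ((1 - t) *\<^sub>R u + t *\<^sub>R v) $ i * ln (((1 - t) *\<^sub>R u + t *\<^sub>R v) $ i))
        \<le> (1 - t) * (\<Sum>i\<in>UNIV. u $ i * ln (u $ i)) + t * (\<Sum>i\<in>UNIV. v $ i * ln (v $ i))"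
      by (simp add: sum.distrib sum_distrib_left)
  qed simp
  moreover have "\<forall>y\<in>permutations_of_vec x.
      (\<Sum>i\<in>UNIV. y $ i * ln (y $ i)) \<le> (\<Sum>i\<in>UNIV. x $ i * ln (x $ i))"
    using sum.permute[of _ UNIV "\<lambda>i. x $ i * ln (x $ i)"]
    by (auto simp: permutations_of_vec_def o_def)
  ultimately show ?thesis
    using convex_on_convex_hull_bound y by blast
qed

section \<open>Diagonal density matrices\<close>

definition real_diag :: "real^'n \<Rightarrow> complex^'n^'n" where
  "real_diag x = diag_mat (\<chi> i. of_real (x $ i))"

lemma real_diag_nth: "real_diag x $ i $ j = (if i = j then of_real (x $ i) else 0)"
  by (simp add: real_diag_def diag_mat_def)

lemma linear_real_diag: "linear real_diag"
  by (rule linearI) (auto simp: vec_eq_iff real_diag_nth scaleR_conv_of_real[where 'a = complex])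

text \<open>Inversion maps the set of permutations onto itself, which reconciles the two indexings,
  and a linear map commutes with the convex hull.\<close>

lemma polytope_of_real_diag:
  "polytope_of (real_diag x) = real_diag ` (convex hull permutations_of_vec x)"
proof -
  let ?P = "{p :: 'a \<Rightarrow> 'a. p permutes UNIV}"
  let ?f = "\<lambda>p. \<chi> i. x $ inv p i"
  have "permutations_of_vec x = ?f ` ?P"
  proof -
    have "p \<in> inv ` ?P" if "p permutes UNIV" for p
      using that by (intro image_eqI[of _ _ "inv p"]) (auto simp: permutes_inv permutes_inv_inv)
    hence "?P = inv ` ?P"
      by (auto simp: permutes_inv)
    from arg_cong[OF this, of "image (\<lambda>q. \<chi> i. x $ q i)"] show ?thesis
      unfolding permutations_of_vec_def image_image .
  qed
  hence "real_diag ` (convex hull permutations_of_vec x) = convex hull ((\<lambda>p. real_diag (?f p)) ` ?P)"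
    by (simp add: convex_hull_linear_image[OF linear_real_diag] image_image)
  also have "\<dots> = polytope_of (real_diag x)"
    by (simp add: convex_hull_finite_family finite_permutations polytope_of_def real_diag_def diag_mat_def)
  finally show ?thesis by simp
qed

lemma adj_mat_one: "adj (mat 1) = mat 1"
  by (auto simp: adj_def mat_def vec_eq_iff)

text \<open>The matrix is already diagonalised by the identity, and \<open>mat_fun\<close> may be
  computed from any spectral representation.\<close>

lemma entropy_real_diag: "entropy (real_diag x) = - (\<Sum>i\<in>UNIV. x $ i * ln (x $ i))"
proof -
  have "spectral_rep (real_diag x) (mat 1) x"
    by (simp add: spectral_rep_def unitary_mat_def adj_mat_one real_diag_def)
  hence "mat_fun ln (real_diag x) = diag_mat (\<chi> i. of_real (ln (x $ i)))"
    by (simp add: mat_fun_eq adj_mat_one)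
  thus ?thesis
    by (simp add: entropy_def trace_def diag_mat_mult real_diag_nth)
qed

lemma real_diag_in_diag_density:
  assumes "prob_vec x"
  shows "real_diag x \<in> diag_density"
proof -
  have "adj (real_diag x) = real_diag x"
    by (auto simp: adj_def vec_eq_iff real_diag_nth)
  moreover have "0 \<le> Re (\<Sum>i\<in>UNIV. cnj (v $ i) * (real_diag x *v v) $ i)" for v
  proof -
    have "(real_diag x *v v) $ i = of_real (x $ i) * v $ i" for i
      by (simp add: matrix_vector_mult_def real_diag_nth if_distrib if_distribR cong: if_cong)
    hence "Re (cnj (v $ i) * (real_diag x *v v) $ i) = x $ i * (cmod (v $ i))\<^sup>2" for i
      by (simp add: cmod_power2) (simp add: power2_eq_square algebra_simps)
    thus ?thesis
      using assms by (auto simp: prob_vec_def intro!: sum_nonneg)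
  qed
  moreover have "trace (real_diag x) = 1"
    using assms by (simp add: trace_def real_diag_nth prob_vec_def flip: of_real_sum)
  ultimately show ?thesis
    by (simp add: diag_density_def density_matrix_def psd_def is_diag_def real_diag_nth)
qed

section \<open>The measurement process\<close>

lemma measurement_eq: "measurement A = diag_mat (\<chi> i. A $ i $ i)"
proof -
  have "proj f $ i $ j = (if i = f \<and> j = f then 1 else 0)" for f i j :: 'a
    by (auto simp: proj_def ket_bra_def axis_def)
  hence "proj f = diag_mat (\<chi> i. if i = f then 1 else 0)" for f :: 'a
    by (auto simp: vec_eq_iff diag_mat_def)
  hence "(proj f ** A ** proj f) $ i $ j = (if i = f then A $ i $ j * (if j = f then 1 else 0) else 0)" for f i j
    by (simp add: diag_mat_mult)
  thus ?thesis
    by (auto simp: measurement_def vec_eq_iff diag_mat_def)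
qed

lemma measurement_density_matrix:
  assumes "density_matrix \<rho>"
  shows "\<exists>x. prob_vec x \<and> measurement \<rho> = real_diag x"
proof -
  define x :: "real^'a" where "x = (\<chi> i. Re (\<rho> $ i $ i))"
  have psd: "psd \<rho>" and adj: "adj \<rho> = \<rho>" and tr: "trace \<rho> = 1"
    using assms by (auto simp: density_matrix_def psd_def)
  have "cnj (\<rho> $ i $ i) = \<rho> $ i $ i" for i
    using arg_cong[OF adj, of "\<lambda>A. A $ i $ i"] by (simp add: adj_def)
  hence real: "\<rho> $ i $ i = of_real (x $ i)" for i
    by (simp add: x_def complex_eq_iff)
  have "0 \<le> x $ i" for i
  proof -
    \<comment> \<open>Positivity is tested on a basis vector, which picks out a diagonal
      entry.\<close>
    have "0 \<le> Re (\<Sum>j\<in>UNIV. cnj (axis i 1 $ j) * (\<rho> *v axis i 1) $ j)"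
      using psd by (simp add: psd_def)
    also have "(\<Sum>j\<in>UNIV. cnj (axis i 1 $ j) * (\<rho> *v axis i 1) $ j) = \<rho> $ i $ i"
      by (simp add: axis_def matrix_vector_mult_def if_distrib if_distribR cong: if_cong)
    finally show ?thesis by (simp add: x_def)
  qed
  moreover have "(\<Sum>i\<in>UNIV. x $ i) = 1"
    using arg_cong[OF tr, of Re] by (simp add: trace_def x_def)
  ultimately show ?thesis
    by (intro exI[of _ x]) (simp add: prob_vec_def measurement_eq real_diag_def real)
qed

text \<open>Row \<open>i\<close> is the new outcome and column \<open>j\<close> the previous one.
  The indices of \<open>U\<close> are swapped because the evolution is
  \<open>adj U ** \<rho> ** U\<close>.\<close>

definition transition_mat :: "complex^'n^'n \<Rightarrow> real^'n^'n" where
  "transition_mat U = (\<chi> i j. (cmod (U $ j $ i))\<^sup>2)"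

text \<open>Row sums are diagonal entries of \<open>adj U ** U\<close>, column sums those of
  \<open>U ** adj U\<close>.\<close>

lemma doubly_stochastic_transition_mat:
  assumes "unitary_mat U"
  shows "doubly_stochastic (transition_mat U)"
proof -
  have "of_real (\<Sum>j\<in>UNIV. (cmod (U $ j $ i))\<^sup>2) = (adj U ** U) $ i $ i"
    "of_real (\<Sum>i\<in>UNIV. (cmod (U $ j $ i))\<^sup>2) = (U ** adj U) $ j $ j" for i j
    by (simp_all add: adj_def matrix_matrix_mult_def mult.commute complex_norm_square
        flip: of_real_power)
  hence "complex_of_real (\<Sum>j\<in>UNIV. (cmod (U $ j $ i))\<^sup>2) = of_real 1"
    "complex_of_real (\<Sum>i\<in>UNIV. (cmod (U $ j $ i))\<^sup>2) = of_real 1" for i j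
    using assms by (simp_all add: unitary_mat_def mat_def)
  thus ?thesis
    unfolding of_real_eq_iff by (simp add: doubly_stochastic_def transition_mat_def)
qed

lemma measurement_evolution:
  "measurement (adj U ** real_diag x ** U) = real_diag (transition_mat U *v x)"
proof -
  have "(adj U ** real_diag x ** U) $ i $ i = of_real ((transition_mat U *v x) $ i)" for i
  proof -
    have "(adj U ** real_diag x ** U) $ i $ i = (\<Sum>j\<in>UNIV. cnj (U $ j $ i) * of_real (x $ j) * U $ j $ i)"
      by (subst matrix_matrix_mult_def) (simp add: real_diag_def diag_mat_mult adj_def)
    also have "\<dots> = (\<Sum>j\<in>UNIV. of_real ((cmod (U $ j $ i))\<^sup>2 * x $ j))"
      by (intro sum.cong refl) (simp only: of_real_mult complex_norm_square, simp)
    finally show ?thesis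
      by (simp add: transition_mat_def matrix_vector_mult_def)
  qed
  thus ?thesis by (simp add: measurement_eq real_diag_def)
qed

section \<open>Minimum entropy and the chain of polytopes\<close>

lemma min_entropy_eq:
  assumes "is_arg_min entropy (\<lambda>\<sigma>. \<sigma> \<in> K) \<sigma>"
  shows "min_entropy K = entropy \<sigma>"
  unfolding min_entropy_def
  by (rule Least_equality) (use assms in \<open>auto simp: is_arg_min_linorder\<close>)

lemma is_arg_min_entropy_polytope_of:
  assumes "prob_vec x"
  shows "is_arg_min entropy (\<lambda>\<sigma>. \<sigma> \<in> polytope_of (real_diag x)) (real_diag x)"
  using neg_entropy_hull_permutations_le[OF assms]
  by (auto simp: is_arg_min_linorder polytope_of_real_diag entropy_real_diag
      intro!: imageI hull_inc self_in_permutations_of_vec)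

lemma max_mixed_subset_polytope_of:
  fixes x :: "real^'n"
  assumes "prob_vec x"
  shows "max_mixed \<subseteq> polytope_of (real_diag x)"
proof -
  \<comment> \<open>The constant matrix averages every probability vector to the uniform
    one.\<close>
  define T :: "real^'n^'n" where "T = (\<chi> i j. 1 / real CARD('n))"
  have "doubly_stochastic T"
    by (simp add: doubly_stochastic_def T_def)
  hence "real_diag (T *v x) \<in> polytope_of (real_diag x)"
    unfolding polytope_of_real_diag by (intro imageI doubly_stochastic_in_hull)
  moreover have "T *v x = (\<chi> i. 1 / real CARD('n))"
    using assms by (simp add: T_def matrix_vector_mult_def prob_vec_def vec_eq_iff
        flip: sum_divide_distrib)
  moreover have "real_diag (\<chi> i. 1 / real CARD('n)) = (1 / real CARD('n)) *\<^sub>R (mat 1 :: complex^'n^'n)"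
    by (auto simp: vec_eq_iff real_diag_nth mat_def scaleR_conv_of_real[where 'a = complex])
  ultimately show ?thesis
    by (simp add: max_mixed_def)
qed

lemma polytope_of_subset_diag_density:
  assumes "prob_vec x"
  shows "polytope_of (real_diag x) \<subseteq> diag_density"
  unfolding polytope_of_real_diag
  using hull_permutations_prob_vec[OF assms] real_diag_in_diag_density by blast

text \<open>The bound on \<open>s\<close> excludes the first measurement, which acts on
  \<open>\<rho>\<close> with no evolution before it.\<close>

lemma state_Suc_real_diag:
  assumes "s \<ge> 1" "state \<rho> V s = real_diag x"
  shows "state \<rho> V (Suc s) = real_diag (transition_mat (V s) *v x)"
  using assms measurement_evolution[of "V s" x] by (cases s) auto

lemma state_real_diag:
  assumes "density_matrix \<rho>" "\<And>s. s \<ge> 1 \<Longrightarrow> unitary_mat (V s)" "s \<ge> 1"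
  shows "\<exists>x. prob_vec x \<and> state \<rho> V s = real_diag x"
  using assms(3)
proof (induction s rule: dec_induct)
  case base
  show ?case using measurement_density_matrix[OF assms(1)] by simp
next
  case (step s)
  then obtain x where "prob_vec x" "state \<rho> V s = real_diag x" by blast
  thus ?case
    using state_Suc_real_diag[OF step(1)] prob_vec_doubly_stochastic
      doubly_stochastic_transition_mat[OF assms(2)[OF step(1)]] by blast
qed

theorem mainTheorem5:
  fixes \<rho> :: "complex^'n^'n" and V :: "nat \<Rightarrow> complex^'n^'n"
  assumes "density_matrix \<rho>"
    and "\<And>s. s \<ge> 1 \<Longrightarrow> unitary_mat (V s)"
  shows "(\<forall>s\<ge>1.
            (\<forall>t>s. state \<rho> V t \<in> polytope_of (state \<rho> V s)) \<and>
            is_arg_min entropy (\<lambda>\<sigma>. \<sigma> \<in> polytope_of (state \<rho> V s)) (state \<rho> V s) \<and>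
            min_entropy (polytope_of (state \<rho> V s)) = entropy (state \<rho> V s) \<and>
            max_mixed \<subseteq> polytope_of (state \<rho> V (s + 1)) \<and>
            polytope_of (state \<rho> V (s + 1)) \<subseteq> polytope_of (state \<rho> V s) \<and>
            polytope_of (state \<rho> V s) \<subseteq> diag_density) \<and>
         mono_on {1..} (\<lambda>s. min_entropy (polytope_of (state \<rho> V s)))"
proof -
  let ?B = "\<lambda>s. polytope_of (state \<rho> V s)"
  have diag: "\<exists>x. prob_vec x \<and> state \<rho> V s = real_diag x" if "s \<ge> 1" for s
    using state_real_diag assms that by blast
  have arg_min: "is_arg_min entropy (\<lambda>\<sigma>. \<sigma> \<in> ?B s) (state \<rho> V s)" if "s \<ge> 1" for s
    using diag[OF that] is_arg_min_entropy_polytope_of by metis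
  have mixed: "max_mixed \<subseteq> ?B s" if "s \<ge> 1" for s
    using diag[OF that] max_mixed_subset_polytope_of by metis
  have density: "?B s \<subseteq> diag_density" if "s \<ge> 1" for s
    using diag[OF that] polytope_of_subset_diag_density by metis
  have shrink: "?B (Suc s) \<subseteq> ?B s" if s: "s \<ge> 1" for s
  proof -
    obtain x where x: "state \<rho> V s = real_diag x" using diag[OF s] by blast
    show ?thesis
      unfolding state_Suc_real_diag[OF s x] x polytope_of_real_diag
      by (intro image_mono hull_permutations_doubly_stochastic doubly_stochastic_transition_mat
          assms(2) s)
  qed
  have antimono: "?B t \<subseteq> ?B s" if "1 \<le> s" "s \<le> t" for s t
    using that(2)
  proof (induction t rule: dec_induct)
    case (step t)
    thus ?case using shrink[of t] that(1) by auto
  qed simp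
  \<comment> \<open>Each state lies in its own polytope, being a minimiser there, and nesting
    carries it into the earlier ones.\<close>
  have mem: "state \<rho> V t \<in> ?B s" if "1 \<le> s" "s \<le> t" for s t
    using antimono[OF that] arg_min[of t] that by (auto simp: is_arg_min_linorder)
  have "mono_on {1..} (\<lambda>s. min_entropy (?B s))"
  proof (rule mono_onI)
    fix s t :: nat
    assume st: "s \<in> {1..}" "t \<in> {1..}" "s \<le> t"
    \<comment> \<open>The later state competes in the earlier polytope, where
      \<open>state \<rho> V s\<close> is a minimiser.\<close>
    hence "entropy (state \<rho> V s) \<le> entropy (state \<rho> V t)"
      using mem[of s t] arg_min[of s] by (auto simp: is_arg_min_linorder)
    thus "min_entropy (?B s) \<le> min_entropy (?B t)"
      using st min_entropy_eq[OF arg_min] by simp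
  qed
  thus ?thesis
    using mem arg_min min_entropy_eq[OF arg_min] mixed shrink density by simp
qed

end
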